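(* Among all finite, connected, simple $3$-regular $4$-ordered hamiltonian graphs other than $K_4$ and $K_{3,3}$, the Heawood graph has the fewest vertices. That is, every finite connected simple $3$-regular $4$-ordered hamiltonian graph not isomorphic to $K_4$ or $K_{3,3}$ has at least $14$ vertices, and the Heawood graph (which has $14$ vertices) is $3$-regular and $4$-ordered hamiltonian.
   Context: A simple graph $G$ is called $k$-ordered hamiltonian if for every sequence $v_1,\ldots,v_k$ of $k$ distinct vertices of $G$ there exists a hamiltonian cycle in $G$ containing these $k$ vertices in the specified (cyclic) order. The Heawood graph is the $3$-regular bipartite graph on $14$ vertices given by the point–line incidence graph of the Fano plane; equivalently, it is the graph with vertices $0,1,\ldots,13$ forming a hamiltonian cycle $0-1-2-\cdots-13-0$, together with the chords joining $i$ and $i+5 \pmod{14}$ for every even $i$. *)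

theory Defs
  imports Main "HOL-Library.Sublist"
begin

text \<open>A finite simple graph: finite vertex set V and a symmetric, irreflexive
  adjacency relation E whose edges lie inside V.\<close>
definition simple_graph :: "'a set \<Rightarrow> ('a \<Rightarrow> 'a \<Rightarrow> bool) \<Rightarrow> bool" where
  "simple_graph V E \<longleftrightarrow> finite V \<and> (\<forall>u v. E u v \<longrightarrow> u \<in> V \<and> v \<in> V)
     \<and> (\<forall>u v. E u v \<longrightarrow> E v u) \<and> (\<forall>v. \<not> E v v)"

definition connected_graph :: "'a set \<Rightarrow> ('a \<Rightarrow> 'a \<Rightarrow> bool) \<Rightarrow> bool" where
  "connected_graph V E \<longleftrightarrow> V \<noteq> {} \<and> (\<forall>u\<in>V. \<forall>v\<in>V. (u, v) \<in> {(x, y). E x y}\<^sup>*)"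

definition regular_graph :: "nat \<Rightarrow> 'a set \<Rightarrow> ('a \<Rightarrow> 'a \<Rightarrow> bool) \<Rightarrow> bool" where
  "regular_graph d V E \<longleftrightarrow> (\<forall>v\<in>V. card {u\<in>V. E v u} = d)"

text \<open>A hamiltonian cycle, given as the list of its vertices in traversal order:
  every vertex occurs exactly once, there are at least 3 vertices, consecutive
  vertices are adjacent and the last vertex is adjacent to the first.\<close>
definition ham_cycle :: "'a set \<Rightarrow> ('a \<Rightarrow> 'a \<Rightarrow> bool) \<Rightarrow> 'a list \<Rightarrow> bool" where
  "ham_cycle V E cs \<longleftrightarrow> distinct cs \<and> set cs = V \<and> length cs \<ge> 3
     \<and> (\<forall>i < length cs. E (cs ! i) (cs ! ((i + 1) mod length cs)))"

text \<open>The cycle cs contains the vertices vs in the specified cyclic order: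
  after starting the cycle at a suitable vertex, vs is a subsequence.
  (Both traversal directions are covered, since the reverse of a hamiltonian
  cycle list is again one.)\<close>
definition cyclic_order_in :: "'a list \<Rightarrow> 'a list \<Rightarrow> bool" where
  "cyclic_order_in vs cs \<longleftrightarrow> (\<exists>n. subseq vs (rotate n cs))"

definition k_ordered_hamiltonian :: "nat \<Rightarrow> 'a set \<Rightarrow> ('a \<Rightarrow> 'a \<Rightarrow> bool) \<Rightarrow> bool" where
  "k_ordered_hamiltonian k V E \<longleftrightarrow>
     (\<forall>vs. length vs = k \<and> distinct vs \<and> set vs \<subseteq> V \<longrightarrow>
        (\<exists>cs. ham_cycle V E cs \<and> cyclic_order_in vs cs))"

definition graph_iso :: "'a set \<Rightarrow> ('a \<Rightarrow> 'a \<Rightarrow> bool) \<Rightarrow> 'b set \<Rightarrow> ('b \<Rightarrow> 'b \<Rightarrow> bool) \<Rightarrow> bool" where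
  "graph_iso V E W F \<longleftrightarrow> (\<exists>f. bij_betw f V W \<and> (\<forall>u\<in>V. \<forall>v\<in>V. E u v \<longleftrightarrow> F (f u) (f v)))"

definition K4_V :: "nat set" where "K4_V = {0..<4}"
definition K4_E :: "nat \<Rightarrow> nat \<Rightarrow> bool" where
  "K4_E u v \<longleftrightarrow> u \<in> K4_V \<and> v \<in> K4_V \<and> u \<noteq> v"

definition K33_V :: "nat set" where "K33_V = {0..<6}"
definition K33_E :: "nat \<Rightarrow> nat \<Rightarrow> bool" where
  "K33_E u v \<longleftrightarrow> u \<in> K33_V \<and> v \<in> K33_V \<and> ((u < 3) \<noteq> (v < 3))"

text \<open>Heawood graph: cycle 0-1-...-13-0 plus chords {i, i+5 mod 14} for even i.\<close>
definition heawood_V :: "nat set" where "heawood_V = {0..<14}"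
definition heawood_E :: "nat \<Rightarrow> nat \<Rightarrow> bool" where
  "heawood_E u v \<longleftrightarrow> u \<in> heawood_V \<and> v \<in> heawood_V \<and>
     (v = (u + 1) mod 14 \<or> u = (v + 1) mod 14 \<or>
      (even u \<and> v = (u + 5) mod 14) \<or> (even v \<and> u = (v + 5) mod 14))"

end

theory Submission imports Defs begin

text \<open>If a, b, c, d are visited in this order, then b and d separate a from c on the cycle. Hence for
  any two disjoint edges ac and bd there is a hamiltonian cycle using neither. In a cubic graph this
  forces both remaining edges at each of the four endpoints: omitting two external edges of a triangle
  or of a square would close up that triangle or square. So, beyond K4 and K33, triangles and squares
  are excluded. Label the vertices 0, ..., n - 1 along a hamiltonian cycle; the rest of the graph is an
  involution without fixed points, so n is even. Girth 5 leaves no chord system for n = 8 and n = 10,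
  and 24 of them for n = 12. Each of these has two disjoint edges such that every perfect matching
  containing both has a disconnected complement, although the complement of some such matching is a
  hamiltonian cycle.

  For the Heawood graph, a dihedral group of order 14 acts simply transitively on the vertices, so only
  sequences starting in 0 have to be checked against a list of hamiltonian cycles.\<close>

section \<open>Adjacency on hamiltonian cycles\<close>

definition cyc_adj :: "'a list \<Rightarrow> 'a \<Rightarrow> 'a \<Rightarrow> bool" where
  "cyc_adj cs u v \<longleftrightarrow> (\<exists>i<length cs. {u, v} = {cs ! i, cs ! ((i + 1) mod length cs)})"

lemma cyc_adj_sym: "cyc_adj cs u v \<longleftrightarrow> cyc_adj cs v u"
  by (simp add: cyc_adj_def insert_commute)

lemma cyc_adj_edge:
  assumes "simple_graph V E" "ham_cycle V E cs" "cyc_adj cs u v"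
  shows "E u v"
proof -
  obtain i where "i < length cs" "{u, v} = {cs ! i, cs ! ((i + 1) mod length cs)}"
    using assms(3) unfolding cyc_adj_def by blast
  then show ?thesis using assms(1,2) unfolding ham_cycle_def simple_graph_def doubleton_eq_iff by auto
qed

text \<open>\<open>p\<close> is the cyclic predecessor of \<open>i\<close>, given by cases because
  subtraction on naturals truncates.\<close>

lemma cyclic_predecessor:
  fixes i j n :: nat
  assumes "3 \<le> n" "i < n"
  defines "p \<equiv> if i = 0 then n - 1 else i - 1"
  shows "p < n" "(i + 1) mod n < n" "(i + 1) mod n \<noteq> p" "(p + 1) mod n = i"
    "\<lbrakk>j < n; (j + 1) mod n = i\<rbrakk> \<Longrightarrow> j = p"
proof -
  have s: "(j + 1) mod n = (if j + 1 = n then 0 else j + 1)" if "j < n" for j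
    using that by simp
  show p: "p < n" using assms(1,2) unfolding p_def by auto
  show "(i + 1) mod n < n" "(i + 1) mod n \<noteq> p" "(p + 1) mod n = i"
    unfolding s[OF assms(2)] s[OF p] using assms(1,2) unfolding p_def by auto
  show "\<lbrakk>j < n; (j + 1) mod n = i\<rbrakk> \<Longrightarrow> j = p"
    using s[of j] unfolding p_def by (auto split: if_splits)
qed

text \<open>The neighbours are the entries after and before \<open>v\<close>; length at least 3
  keeps these two distinct.\<close>

lemma cyc_adj_neighbours:
  assumes "ham_cycle V E cs" "v \<in> V"
  shows "card {u. cyc_adj cs v u} = 2"
proof -
  let ?n = "length cs"
  have n: "?n \<ge> 3" and d: "distinct cs" using assms(1) by (auto simp: ham_cycle_def)
  obtain i where i: "i < ?n" "v = cs ! i"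
    using assms by (metis ham_cycle_def in_set_conv_nth)
  define s p where "s = (i + 1) mod ?n" and "p = (if i = 0 then ?n - 1 else i - 1)"
  note ps = cyclic_predecessor[OF n i(1), folded s_def p_def]
  have "{u. cyc_adj cs v u} = {cs ! s, cs ! p}"
  proof (intro equalityI subsetI)
    fix u assume "u \<in> {u. cyc_adj cs v u}"
    then obtain j where j: "j < ?n" "{v, u} = {cs ! j, cs ! ((j + 1) mod ?n)}"
      unfolding cyc_adj_def by blast
    have lt: "(j + 1) mod ?n < ?n" using j(1) by (intro mod_less_divisor) linarith
    consider "v = cs ! j" "u = cs ! ((j + 1) mod ?n)" | "u = cs ! j" "v = cs ! ((j + 1) mod ?n)"
      using j(2) unfolding doubleton_eq_iff by blast
    then show "u \<in> {cs ! s, cs ! p}"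
    proof cases
      case 1
      then have "j = i" using d i j(1) nth_eq_iff_index_eq by metis
      then show ?thesis using 1(2) unfolding s_def by blast
    next
      case 2
      then have "(j + 1) mod ?n = i" using d i lt nth_eq_iff_index_eq by metis
      then show ?thesis using ps(5) j(1) 2(1) by blast
    qed
  next
    fix u assume "u \<in> {cs ! s, cs ! p}"
    then have "{v, u} = {cs ! i, cs ! ((i + 1) mod ?n)} \<or> {v, u} = {cs ! p, cs ! ((p + 1) mod ?n)}"
      unfolding ps(4) i(2) s_def[symmetric] by blast
    then show "u \<in> {u. cyc_adj cs v u}" using i(1) ps(1) unfolding cyc_adj_def by blast
  qed
  moreover have "cs ! s \<noteq> cs ! p" using d ps(1-3) nth_eq_iff_index_eq by metis
  ultimately show ?thesis by (metis card_2_iff)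
qed

text \<open>Walking along the cycle from one vertex of \<open>S\<close> reaches all of them. In the
  triangle and square arguments this clashes with a vertex outside \<open>S\<close>.\<close>

lemma cyc_adj_closed:
  assumes H: "ham_cycle V E cs" and "S \<subseteq> V" "S \<noteq> {}"
    and closed: "\<And>u v. u \<in> S \<Longrightarrow> cyc_adj cs u v \<Longrightarrow> v \<in> S"
  shows "S = V"
proof -
  let ?n = "length cs"
  have n: "?n > 0" and V: "set cs = V" using H by (auto simp: ham_cycle_def)
  obtain i where i: "i < ?n" "cs ! i \<in> S"
    using assms(2,3) V by (metis all_not_in_conv in_set_conv_nth subsetD)
  have "cs ! ((i + k) mod ?n) \<in> S" for k
  proof (induction k)
    case 0 then show ?case using i by simp
  next
    case (Suc k)
    have "cyc_adj cs (cs ! ((i + k) mod ?n)) (cs ! ((i + Suc k) mod ?n))"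
      unfolding cyc_adj_def using n
      by (intro exI[of _ "(i + k) mod ?n"]) (simp add: mod_Suc_eq)
    then show ?case using closed Suc by blast
  qed
  \<comment> \<open>From position \<open>i\<close>, going \<open>?n - i\<close> steps wraps round to
    0, and \<open>j\<close> more steps reach \<open>j\<close>.\<close>
  moreover have "\<exists>k. (i + k) mod ?n = j" if "j < ?n" for j
    using that i by (intro exI[of _ "?n - i + j"]) simp
  ultimately have "cs ! j \<in> S" if "j < ?n" for j using that by metis
  then have "V \<subseteq> S" using V by (metis in_set_conv_nth subsetI)
  then show ?thesis using assms(2) by blast
qed

lemma ham_cycle_rotate:
  assumes "ham_cycle V E cs"
  shows "ham_cycle V E (rotate n cs)"
  unfolding ham_cycle_def
proof (intro conjI allI impI)
  fix i assume i: "i < length (rotate n cs)"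
  let ?l = "length cs"
  have l: "?l > 0" using i by auto
  have "E (cs ! ((n + i) mod ?l)) (cs ! (((n + i) mod ?l + 1) mod ?l))"
    using assms l unfolding ham_cycle_def by simp
  moreover have "((n + i) mod ?l + 1) mod ?l = (n + (i + 1) mod ?l) mod ?l"
    by (metis add.assoc mod_add_left_eq mod_add_right_eq)
  moreover have "rotate n cs ! i = cs ! ((n + i) mod ?l)"
    using i by (simp add: nth_rotate)
  moreover have "rotate n cs ! ((i + 1) mod ?l) = cs ! ((n + (i + 1) mod ?l) mod ?l)"
    using l by (intro nth_rotate mod_less_divisor)
  ultimately show "E (rotate n cs ! i) (rotate n cs ! ((i + 1) mod length (rotate n cs)))"
    by simp
qed (use assms in \<open>simp_all add: ham_cycle_def\<close>)

lemma subseq_four_indices: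
  assumes "subseq [a, b, c, d] xs"
  obtains i j k l where "i < j" "j < k" "k < l" "l < length xs"
    "xs ! i = a" "xs ! j = b" "xs ! k = c" "xs ! l = d"
proof -
  obtain p1 p2 p3 p4 r where xs: "xs = p1 @ a # p2 @ b # p3 @ c # p4 @ d # r"
    using assms by (auto dest!: list_emb_ConsD)
  show thesis
    by (rule that[of "length p1" "length p1 + 1 + length p2" "length p1 + 1 + length p2 + 1 + length p3"
          "length p1 + 1 + length p2 + 1 + length p3 + 1 + length p4"])
      (auto simp: xs nth_append)
qed

text \<open>Adjacent positions are either consecutive or the two ends of the list; the last two
  hypotheses exclude both.\<close>

lemma not_cyc_adj_indices:
  assumes "distinct xs" "i < k" "k < length xs" "k \<noteq> i + 1" "\<not> (i = 0 \<and> k + 1 = length xs)"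
  shows "\<not> cyc_adj xs (xs ! i) (xs ! k)"
proof
  assume "cyc_adj xs (xs ! i) (xs ! k)"
  then obtain j where j: "j < length xs" "{xs ! i, xs ! k} = {xs ! j, xs ! ((j + 1) mod length xs)}"
    by (auto simp: cyc_adj_def)
  have "(j + 1) mod length xs < length xs" using j by (intro mod_less_divisor) auto
  then have "(i = j \<and> k = (j + 1) mod length xs) \<or> (k = j \<and> i = (j + 1) mod length xs)"
    using assms(1-3) j by (auto simp: doubleton_eq_iff nth_eq_iff_index_eq)
  then show False using assms j(1) by (auto simp: mod_Suc split: if_splits)
qed

text \<open>On the cycle, \<open>b\<close> and \<open>d\<close> separate \<open>a\<close> from
  \<open>c\<close>, and \<open>a\<close> and \<open>c\<close> separate \<open>b\<close> from
  \<open>d\<close>. The omitted pairs are thus first with third and second with fourth.\<close>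

lemma ham_cycle_avoiding:
  assumes "k_ordered_hamiltonian 4 V E" "distinct [a, b, c, d]" "{a, b, c, d} \<subseteq> V"
  obtains cs where "ham_cycle V E cs" "\<not> cyc_adj cs a c" "\<not> cyc_adj cs b d"
proof -
  obtain cs n where cs: "ham_cycle V E cs" "subseq [a, b, c, d] (rotate n cs)"
    using assms(1)[unfolded k_ordered_hamiltonian_def, rule_format, of "[a, b, c, d]"] assms(2,3)
    unfolding cyclic_order_in_def by auto
  let ?xs = "rotate n cs"
  have H: "ham_cycle V E ?xs" using cs(1) by (rule ham_cycle_rotate)
  then have d: "distinct ?xs" by (simp add: ham_cycle_def)
  obtain i j k l where *: "i < j" "j < k" "k < l" "l < length ?xs"
    "?xs ! i = a" "?xs ! j = b" "?xs ! k = c" "?xs ! l = d"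
    using subseq_four_indices[OF cs(2)] .
  \<comment> \<open>A position in between prevents consecutiveness; the wraparound is excluded since
    \<open>k\<close> is not last and \<open>j\<close> is not first.\<close>
  have "\<not> cyc_adj ?xs (?xs ! i) (?xs ! k)" "\<not> cyc_adj ?xs (?xs ! j) (?xs ! l)"
    using * d by (intro not_cyc_adj_indices; linarith)+
  then show thesis using that H * by metis
qed

section \<open>Triangles and squares\<close>

locale cubic_4_ordered =
  fixes V :: "'a set" and E :: "'a \<Rightarrow> 'a \<Rightarrow> bool"
  assumes simple: "simple_graph V E" and regular: "regular_graph 3 V E"
    and ordered: "k_ordered_hamiltonian 4 V E"
begin

lemma edge_sym: "E u v \<longleftrightarrow> E v u" and edge_irrefl: "\<not> E v v"
  and edge_in: "E u v \<Longrightarrow> u \<in> V \<and> v \<in> V" and finite_V: "finite V"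
  using simple by (auto simp: simple_graph_def)

lemma card_neighbours: "v \<in> V \<Longrightarrow> card {u. E v u} = 3"
proof -
  have "{u. E v u} = {u \<in> V. E v u}" using edge_in by blast
  then show "v \<in> V \<Longrightarrow> card {u. E v u} = 3" using regular by (simp add: regular_graph_def)
qed

lemma third_neighbour:
  assumes "E v a" "E v b" "a \<noteq> b"
  obtains w where "w \<noteq> a" "w \<noteq> b" "E v w" "\<And>u. E v u \<longleftrightarrow> u = a \<or> u = b \<or> u = w"
proof -
  have 3: "card {u. E v u} = 3" using card_neighbours edge_in assms by blast
  then have fin: "finite {u. E v u}" using card.infinite by fastforce
  have "card ({u. E v u} - {a, b}) = 1"
    using assms 3 fin by (subst card_Diff_subset) auto
  then obtain w where "{u. E v u} - {a, b} = {w}" by (auto simp: card_1_singleton_iff)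
  then show thesis using that[of w] assms by blast
qed

text \<open>A cycle uses two of the three edges at \<open>v\<close>, so omitting one leaves no
  choice.\<close>

lemma cyc_adj_forced:
  assumes H: "ham_cycle V E cs" and N: "\<And>u. E v u \<longleftrightarrow> u = a \<or> u = b \<or> u = w"
    and "\<not> cyc_adj cs v w"
  shows "cyc_adj cs v u \<longleftrightarrow> u = a \<or> u = b"
proof -
  have "v \<in> V" using N edge_in by blast
  then have "card {u. cyc_adj cs v u} = 2" using H cyc_adj_neighbours by metis
  moreover have "{u. cyc_adj cs v u} \<subseteq> {a, b}"
    using cyc_adj_edge[OF simple H] N assms(3) by auto
  moreover have "card {a, b} \<le> 2" by (simp add: card_insert_if)
  ultimately have "{u. cyc_adj cs v u} = {a, b}" by (intro card_seteq) auto
  then show ?thesis by blast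
qed

lemma cyc_adj_pair:
  assumes "ham_cycle V E cs" "cyc_adj cs v a" "cyc_adj cs v b" "a \<noteq> b"
  shows "cyc_adj cs v u \<longleftrightarrow> u = a \<or> u = b"
proof -
  have "v \<in> V" using assms cyc_adj_edge[OF simple] edge_in by blast
  then have 2: "card {u. cyc_adj cs v u} = 2" using assms cyc_adj_neighbours by metis
  then have "finite {u. cyc_adj cs v u}" using card.infinite by force
  then have "{a, b} = {u. cyc_adj cs v u}" using assms 2 by (intro card_seteq) auto
  then show ?thesis by blast
qed

lemma ham_cycle_exists:
  assumes "card V \<ge> 4"
  obtains cs where "ham_cycle V E cs"
proof -
  obtain S where "S \<subseteq> V" "card S = 4" by (meson assms obtain_subset_with_card_n)
  moreover then obtain vs where "set vs = S" "distinct vs"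
    by (metis finite_distinct_list finite_V finite_subset)
  ultimately show thesis
    using ordered that by (metis distinct_card k_ordered_hamiltonian_def)
qed

text \<open>A hamiltonian cycle supplies connectivity, since it runs along edges of the
  graph.\<close>

lemma edge_closed:
  assumes "card V \<ge> 4" "S \<subseteq> V" "S \<noteq> {}" "\<And>u v. u \<in> S \<Longrightarrow> E u v \<Longrightarrow> v \<in> S"
  shows "S = V"
  using assms ham_cycle_exists cyc_adj_closed cyc_adj_edge[OF simple] by metis

text \<open>If the outer neighbours differed, a hamiltonian cycle omitting both outer edges would be
  the triangle itself.\<close>

lemma triangle_third_neighbours:
  assumes x: "\<And>u. E x u \<longleftrightarrow> u = y \<or> u = z \<or> u = w"
    and y: "\<And>u. E y u \<longleftrightarrow> u = x \<or> u = z \<or> u = w'"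
    and w: "w \<noteq> y" "w \<noteq> z" "w' \<noteq> x" "w' \<noteq> z"
  shows "w = w'"
proof (rule ccontr)
  assume "w \<noteq> w'"
  have ne: "x \<noteq> y" "x \<noteq> z" "y \<noteq> z" "x \<noteq> w" "y \<noteq> w'" using x y edge_irrefl by blast+
  have V: "{x, y, z, w, w'} \<subseteq> V" using x y edge_in by blast
  \<comment> \<open>The order \<open>x, y, w, w'\<close> makes the omitted pairs exactly the two
    outer edges.\<close>
  obtain cs where H: "ham_cycle V E cs" "\<not> cyc_adj cs x w" "\<not> cyc_adj cs y w'"
    using ham_cycle_avoiding[OF ordered, of x y w w'] ne V w \<open>w \<noteq> w'\<close> by auto
  have cx: "cyc_adj cs x u \<longleftrightarrow> u = y \<or> u = z" for u using cyc_adj_forced[OF H(1) x H(2)] .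
  have cy: "cyc_adj cs y u \<longleftrightarrow> u = x \<or> u = z" for u using cyc_adj_forced[OF H(1) y H(3)] .
  have cz: "cyc_adj cs z u \<longleftrightarrow> u = x \<or> u = y" for u
    using cyc_adj_pair[OF H(1) _ _ ne(1)] cx cy cyc_adj_sym by metis
  have "{x, y, z} = V"
    by (rule cyc_adj_closed[OF H(1)]) (use V cx cy cz in auto)
  then show False using V w ne by blast
qed

text \<open>All three outer neighbours coincide, so the triangle and this vertex form a K4 that is
  closed under edges.\<close>

lemma no_triangle:
  assumes "card V \<ge> 5" "E a b" "E b c" "E c a"
  shows False
proof -
  have ne: "a \<noteq> b" "b \<noteq> c" "c \<noteq> a" using assms edge_irrefl by blast+
  have E: "E a c" "E b a" "E c b" using assms edge_sym by blast+
  obtain w where w: "w \<noteq> b" "w \<noteq> c" and a: "\<And>u. E a u \<longleftrightarrow> u = b \<or> u = c \<or> u = w"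
    using third_neighbour[OF \<open>E a b\<close> E(1)] ne by metis
  obtain w' where w': "w' \<noteq> a" "w' \<noteq> c" and b: "\<And>u. E b u \<longleftrightarrow> u = a \<or> u = c \<or> u = w'"
    using third_neighbour[OF E(2) \<open>E b c\<close>] ne by metis
  obtain w'' where w'': "w'' \<noteq> a" "w'' \<noteq> b" and c: "\<And>u. E c u \<longleftrightarrow> u = a \<or> u = b \<or> u = w''"
    using third_neighbour[OF \<open>E c a\<close> E(3)] ne by metis
  have eq: "w' = w" using triangle_third_neighbours[OF a b] w w' by metis
  have "w'' = w" using triangle_third_neighbours[of a c b w w''] a c w w'' by metis
  have "E w a" "E w b" "E w c" using a b c eq \<open>w'' = w\<close> edge_sym by blast+
  then have d: "E w u \<longleftrightarrow> u = a \<or> u = b \<or> u = c" for u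
    using third_neighbour[of w a b] ne by metis
  have "{a, b, c, w} = V"
  proof (rule edge_closed)
    show "{a, b, c, w} \<subseteq> V" using a b edge_in by blast
  qed (use assms a b c d eq \<open>w'' = w\<close> in auto)
  moreover have "card {a, b, c, w} \<le> 4" by (simp add: card_insert_if)
  ultimately show False using assms(1) by simp
qed

text \<open>If the third neighbour of \<open>c\<close> were another vertex, omitting the outer edges
  at the opposite corners \<open>a\<close> and \<open>c\<close> would force all four sides and close
  the square.\<close>

lemma square_third_neighbours:
  assumes "card V \<ge> 5" "E a b" "E b c" "E c d" "E d a" "a \<noteq> c" "b \<noteq> d"
    and w: "E a w" "w \<noteq> b" "w \<noteq> d"
  shows "E c w"
proof (rule ccontr)
  assume "\<not> E c w"
  have E: "E b a" "E c b" "E d c" "E a d" using assms edge_sym by blast+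
  have a: "E a u \<longleftrightarrow> u = b \<or> u = d \<or> u = w" for u
    using third_neighbour[OF \<open>E a b\<close> E(4) \<open>b \<noteq> d\<close>] w by metis
  obtain w' where w': "w' \<noteq> b" "w' \<noteq> d" "E c w'" and c: "\<And>u. E c u \<longleftrightarrow> u = b \<or> u = d \<or> u = w'"
    using third_neighbour[OF E(2) \<open>E c d\<close> \<open>b \<noteq> d\<close>] by metis
  \<comment> \<open>A diagonal would create a triangle; its absence keeps \<open>w\<close> apart
    from \<open>c\<close> and \<open>w'\<close> apart from \<open>a\<close>.\<close>
  have "\<not> E a c" using no_triangle[OF assms(1-3)] edge_sym by blast
  then have ne: "w \<noteq> c" "w' \<noteq> a" "w \<noteq> a" "w' \<noteq> c" "w \<noteq> w'"
    using w w' edge_sym edge_irrefl \<open>\<not> E c w\<close> by blast+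
  have V: "{a, b, c, d, w, w'} \<subseteq> V" using a c edge_in by blast
  obtain cs where H: "ham_cycle V E cs" "\<not> cyc_adj cs a w" "\<not> cyc_adj cs c w'"
    using ham_cycle_avoiding[OF ordered, of a c w w'] ne V \<open>a \<noteq> c\<close> by auto
  have ca: "cyc_adj cs a u \<longleftrightarrow> u = b \<or> u = d" for u using cyc_adj_forced[OF H(1) a H(2)] .
  have cc: "cyc_adj cs c u \<longleftrightarrow> u = b \<or> u = d" for u using cyc_adj_forced[OF H(1) c H(3)] .
  have cbd: "cyc_adj cs b u \<longleftrightarrow> u = a \<or> u = c" "cyc_adj cs d u \<longleftrightarrow> u = a \<or> u = c" for u
    using cyc_adj_pair[OF H(1) _ _ \<open>a \<noteq> c\<close>] ca cc cyc_adj_sym by metis+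
  have "{a, b, c, d} = V"
    by (rule cyc_adj_closed[OF H(1)]) (use V ca cc cbd in auto)
  then show False using V w ne by blast
qed

text \<open>Opposite corners share their third neighbours \<open>w\<close> and \<open>x\<close>. The
  same argument for the square \<open>b, c, w, a\<close> makes \<open>w\<close> and \<open>x\<close>
  adjacent, so the six vertices form a K33 closed under edges.\<close>

lemma no_square:
  assumes "card V \<ge> 7" "E a b" "E b c" "E c d" "E d a" "a \<noteq> c" "b \<noteq> d"
  shows False
proof -
  have n: "card V \<ge> 5" using assms(1) by simp
  have E: "E b a" "E c b" "E d c" "E a d" using assms edge_sym by blast+
  obtain w where w: "w \<noteq> b" "w \<noteq> d" "E a w" and a: "\<And>u. E a u \<longleftrightarrow> u = b \<or> u = d \<or> u = w"
    using third_neighbour[OF \<open>E a b\<close> E(4) \<open>b \<noteq> d\<close>] by metis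
  have "E c w" using square_third_neighbours[OF n assms(2-7)] w by blast
  obtain x where x: "x \<noteq> a" "x \<noteq> c" "E b x" and b: "\<And>u. E b u \<longleftrightarrow> u = a \<or> u = c \<or> u = x"
    using third_neighbour[OF E(1) \<open>E b c\<close> \<open>a \<noteq> c\<close>] by metis
  have "E d x" using square_third_neighbours[OF n assms(3-5,2) assms(7)] x assms(6) by blast
  have "E w x"
    using square_third_neighbours[of b c w a x] n assms(2,3,6) w x \<open>E c w\<close> edge_sym[of w a] by metis
  have W: "E w a" "E w c" "E x b" "E x d" "E x w"
    using w x \<open>E c w\<close> \<open>E d x\<close> \<open>E w x\<close> edge_sym by blast+
  have c: "E c u \<longleftrightarrow> u = b \<or> u = d \<or> u = w" for u
    using third_neighbour[OF E(2) \<open>E c d\<close> \<open>b \<noteq> d\<close>] w \<open>E c w\<close> by metis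
  have d: "E d u \<longleftrightarrow> u = a \<or> u = c \<or> u = x" for u
    using third_neighbour[OF \<open>E d a\<close> E(3) \<open>a \<noteq> c\<close>] x \<open>E d x\<close> by metis
  have e: "E w u \<longleftrightarrow> u = a \<or> u = c \<or> u = x" for u
    using third_neighbour[OF W(1,2) \<open>a \<noteq> c\<close>] x \<open>E w x\<close> by metis
  have f: "E x u \<longleftrightarrow> u = b \<or> u = d \<or> u = w" for u
    using third_neighbour[OF W(3,4) \<open>b \<noteq> d\<close>] w W(5) by metis
  have "{a, b, c, d, w, x} = V"
  proof (rule edge_closed)
    show "{a, b, c, d, w, x} \<subseteq> V" using a b edge_in by blast
  qed (use assms(1) a b c d e f in auto)
  moreover have "card {a, b, c, d, w, x} \<le> 6" by (simp add: card_insert_if)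
  ultimately show False using assms(1) by simp
qed

end

section \<open>Chords of a labelled hamiltonian cycle\<close>

text \<open>Relational form of the cyclic successor; it already implies that both indices lie below
  \<open>n\<close>.\<close>

definition nxt :: "nat \<Rightarrow> nat \<Rightarrow> nat \<Rightarrow> bool" where
  "nxt n i j \<longleftrightarrow> j = Suc i \<and> Suc i < n \<or> j = 0 \<and> Suc i = n"

text \<open>Chords spanning at most three steps of the cycle lie in a triangle or a square.\<close>
definition far :: "nat \<Rightarrow> nat \<Rightarrow> nat \<Rightarrow> bool" where
  "far n i j \<longleftrightarrow> (if i \<le> j then i + 4 \<le> j \<and> j + 4 \<le> i + n else j + 4 \<le> i \<and> i + 4 \<le> j + n)"

definition succ :: "nat \<Rightarrow> nat \<Rightarrow> nat" where
  "succ n i = (if Suc i = n then 0 else Suc i)"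

lemma succ_less: "i < n \<Longrightarrow> succ n i < n"
  by (auto simp: succ_def)

lemma nxt_iff_succ: "i < n \<Longrightarrow> nxt n i j \<longleftrightarrow> j = succ n i"
  by (auto simp: nxt_def succ_def)

text \<open>If two vertices are not \<open>far\<close>, one of the arcs between them has at most
  three edges, so one is reached from the other in at most three forward steps.\<close>

lemma not_far_cases:
  assumes "\<not> far n i j" "i < n" "j < n" "n \<ge> 7"
  shows "j \<in> {i, succ n i, succ n (succ n i), succ n (succ n (succ n i))} \<or>
    i \<in> {succ n j, succ n (succ n j), succ n (succ n (succ n j))}"
proof -
  have 1: "succ n i = j" if "j = i + 1 \<or> j + n = i + 1" "i < n" "j < n" for i j
    using that by (auto simp: succ_def)
  have 2: "succ n (succ n i) = j" if "j = i + 2 \<or> j + n = i + 2" "i < n" "j < n" for i j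
    using that \<open>n \<ge> 7\<close> unfolding succ_def by (auto split: if_splits)
  have 3: "succ n (succ n (succ n i)) = j" if "j = i + 3 \<or> j + n = i + 3" "i < n" "j < n" for i j
  proof -
    have "succ n i < n" using that by (simp add: succ_def)
    moreover have "j = succ n i + 2 \<or> j + n = succ n i + 2"
      using that \<open>n \<ge> 7\<close> unfolding succ_def by auto
    ultimately show ?thesis using 2 that by blast
  qed
  have "j = i \<or> (j = i + 1 \<or> j + n = i + 1) \<or> (j = i + 2 \<or> j + n = i + 2) \<or> (j = i + 3 \<or> j + n = i + 3) \<or>
    (i = j + 1 \<or> i + n = j + 1) \<or> (i = j + 2 \<or> i + n = j + 2) \<or> (i = j + 3 \<or> i + n = j + 3)"
    using assms unfolding far_def by (simp split: if_splits) linarith+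
  then show ?thesis using 1[of i j] 1[of j i] 2[of i j] 2[of j i] 3[of i j] 3[of j i] assms(2,3) by fast
qed

text \<open>Normal form: the labels increase along a hamiltonian cycle, and only the chords remain
  unknown.\<close>

locale labelled = cubic_4_ordered "{0..<n}" E for n :: nat and E +
  assumes cycle: "ham_cycle {0..<n} E [0..<n]"
begin

lemma n_ge: "n \<ge> 4"
proof -
  have "0 < n" using cycle by (auto simp: ham_cycle_def)
  then have "card {u. E 0 u} = 3" using card_neighbours by simp
  moreover have "{u. E 0 u} \<subseteq> {0..<n} - {0}" using edge_in edge_irrefl by blast
  then have "card {u. E 0 u} \<le> card ({0..<n} - {0})" by (intro card_mono) auto
  ultimately show ?thesis using \<open>0 < n\<close> by simp
qed

lemma edge_succ: 
  assumes "i < n"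
  shows "E i (succ n i)"
proof -
  have "E ([0..<n] ! i) ([0..<n] ! ((i + 1) mod n))"
    using cycle assms by (auto simp: ham_cycle_def)
  moreover have "(i + 1) mod n = succ n i" using assms by (auto simp: succ_def)
  ultimately show ?thesis using assms succ_less[OF assms] by simp
qed

lemma chord_exists:
  assumes "i < n"
  obtains j where "E i j" "\<And>u. E i u \<longleftrightarrow> nxt n i u \<or> nxt n u i \<or> u = j"
    "\<not> nxt n i j" "\<not> nxt n j i"
proof -
  define p where "p = (if i = 0 then n - 1 else i - 1)"
  have p: "p < n" "succ n p = i" "p \<noteq> succ n i" "\<And>j. j < n \<Longrightarrow> nxt n j i \<longleftrightarrow> j = p"
    using assms n_ge unfolding p_def succ_def nxt_def by auto
  have "E i p" using edge_succ[OF p(1)] p(2) edge_sym by simp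
  then obtain w where w: "w \<noteq> succ n i" "w \<noteq> p" "E i w" "\<And>u. E i u \<longleftrightarrow> u = succ n i \<or> u = p \<or> u = w"
    using third_neighbour[OF edge_succ[OF assms]] p(3) by metis
  have "w < n" using w(3) edge_in by auto
  have "nxt n u i \<Longrightarrow> u < n" for u using assms by (auto simp: nxt_def)
  then show thesis using w p nxt_iff_succ[OF assms] \<open>w < n\<close> that[of w] by metis
qed

text \<open>Choosing with the full neighbourhood description lets \<open>someI_ex\<close> deliver
  all properties at once.\<close>

definition chord :: "nat \<Rightarrow> nat" where
  "chord i = (SOME j. E i j \<and> (\<forall>u. E i u \<longleftrightarrow> nxt n i u \<or> nxt n u i \<or> u = j) \<and> \<not> nxt n i j \<and> \<not> nxt n j i)"

lemma chord:
  assumes "i < n"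
  shows "E i (chord i)" "E i u \<longleftrightarrow> nxt n i u \<or> nxt n u i \<or> u = chord i"
    "\<not> nxt n i (chord i)" "\<not> nxt n (chord i) i"
proof -
  let ?P = "\<lambda>j. E i j \<and> (\<forall>u. E i u \<longleftrightarrow> nxt n i u \<or> nxt n u i \<or> u = j) \<and> \<not> nxt n i j \<and> \<not> nxt n j i"
  have "\<exists>j. ?P j" using chord_exists[OF assms] by metis
  then have "?P (chord i)" unfolding chord_def by (rule someI_ex)
  then show "E i (chord i)" "E i u \<longleftrightarrow> nxt n i u \<or> nxt n u i \<or> u = chord i"
    "\<not> nxt n i (chord i)" "\<not> nxt n (chord i) i" by blast+
qed

lemma chord_less: "i < n \<Longrightarrow> chord i < n"
  using chord(1) edge_in by fastforce

lemma chord_chord: "i < n \<Longrightarrow> chord (chord i) = i"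
  using chord[of i] chord(2)[of "chord i" i] chord_less edge_sym by metis

lemma chord_neq: "i < n \<Longrightarrow> chord i \<noteq> i"
  using chord(1) edge_irrefl by metis

text \<open>A fixed-point-free involution splits the vertices into pairs; the induction removes one
  pair at a time.\<close>

lemma even_n: "even n"
proof -
  have "even (card S)" if "finite S" "S \<subseteq> {0..<n}" "chord ` S \<subseteq> S" for S
    using that
  proof (induction "card S" arbitrary: S rule: less_induct)
    case less
    show ?case
    proof (cases "S = {}")
      case False
      then obtain i where i: "i \<in> S" by blast
      then have j: "i < n" "chord i \<in> S" "chord i \<noteq> i" "chord (chord i) = i"
        using less.prems chord_neq chord_chord by auto
      let ?T = "S - {i, chord i}"
      have c: "card ?T + 2 = card S"
        using i j less.prems(1) card_mono[of S "{i, chord i}"]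
        by (subst card_Diff_subset) auto
      have "chord k \<in> ?T" if "k \<in> ?T" for k
      proof -
        have "k < n" "chord k \<in> S" using that less.prems by auto
        then show ?thesis using that j chord_chord by (metis Diff_iff insert_iff singletonD)
      qed
      then have "even (card ?T)" using less c by (intro less.hyps) auto
      then have "even (card ?T + 2)" by simp
      then show ?thesis unfolding c .
    qed simp
  qed
  from this[of "{0..<n}"] show ?thesis using chord_less by (simp add: image_subset_iff)
qed

text \<open>A chord across two cycle edges closes a triangle, and one across three closes a
  square.\<close>

lemma chord_far:
  assumes "n \<ge> 7" "i < n"
  shows "far n i (chord i)"
proof (rule ccontr)
  assume "\<not> far n i (chord i)"
  \<comment> \<open>The pair \<open>(k, l)\<close> orients the chord so that the short arc runs
    forward from \<open>k\<close> to \<open>l\<close>.\<close>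
  then obtain k l where kl: "(k, l) \<in> {(i, chord i), (chord i, i)}"
    "l \<in> {k, succ n k, succ n (succ n k), succ n (succ n (succ n k))}"
    using not_far_cases[OF _ assms(2) chord_less[OF assms(2)] assms(1)] by fast
  have E: "E k l" "k \<noteq> l" "\<not> nxt n k l" "k < n" "l < n"
    using kl(1) chord(1,3,4)[OF assms(2)] chord_neq[OF assms(2)] chord_less[OF assms(2)] assms(2)
      edge_sym[of i "chord i"] by (elim insertE; simp)+
  let ?a = "succ n k" and ?b = "succ n (succ n k)" and ?c = "succ n (succ n (succ n k))"
  have e: "E k ?a" "E ?a ?b" "E ?b ?c" "?a < n" "?b < n" using edge_succ succ_less E by auto
  have ne: "?a \<noteq> ?c" "k \<noteq> ?b" using E assms(1) by (auto simp: succ_def)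
  consider "l = ?b" | "l = ?c" using kl(2) E nxt_iff_succ by auto
  then show False
  proof cases
    case 1 then show False using no_triangle[OF _ e(1,2)] E(1) edge_sym assms(1) by auto
  next
    case 2 then show False using no_square[OF _ e(1-3)] ne E(1) edge_sym assms(1) by auto
  qed
qed

text \<open>Two such chords would form a square with the two cycle edges joining their ends.\<close>

lemma chord_not_parallel:
  assumes "n \<ge> 7" "i < n" "j < n" "nxt n i j"
  shows "\<not> nxt n (chord i) (chord j)" "\<not> nxt n (chord j) (chord i)"
proof -
  have "E i j" using chord(2) assms by blast
  have "i \<noteq> chord j" "j \<noteq> chord i" using chord assms by metis+
  then have "\<not> E (chord j) (chord i)"
    using no_square[OF _ \<open>E i j\<close> chord(1)[OF assms(3)], of "chord i"] chord(1)[OF assms(2)] edge_sym assms(1)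
    by (metis card_atLeastLessThan diff_zero)
  then show "\<not> nxt n (chord i) (chord j)" "\<not> nxt n (chord j) (chord i)"
    using chord(2) assms chord_less by blast+
qed

end

section \<open>Enumeration of chord systems\<close>

text \<open>Search for assignments with values in the domains \<open>D\<close> that satisfy the
  binary constraint \<open>R\<close>. The tail is assigned first, so inconsistent partial
  assignments are discarded early.\<close>

fun solutions :: "(nat \<Rightarrow> nat \<Rightarrow> nat \<Rightarrow> nat \<Rightarrow> bool) \<Rightarrow> (nat \<Rightarrow> nat list) \<Rightarrow> nat list \<Rightarrow> (nat \<times> nat) list list" where
  "solutions R D [] = [[]]"
| "solutions R D (i # is) =
     concat (map (\<lambda>xs. map (\<lambda>v. (i, v) # xs)
        (filter (\<lambda>v. list_all (\<lambda>(j, w). R i v j w) xs) (D i))) (solutions R D is))"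

text \<open>A consistent assignment survives every filter, so checks on the computed list apply to
  an unknown \<open>f\<close>.\<close>

lemma solutions_complete:
  assumes "distinct is" "\<And>i. i \<in> set is \<Longrightarrow> f i \<in> set (D i)"
    "\<And>i j. i \<in> set is \<Longrightarrow> j \<in> set is \<Longrightarrow> i \<noteq> j \<Longrightarrow> R i (f i) j (f j)"
  shows "map (\<lambda>i. (i, f i)) is \<in> set (solutions R D is)"
  using assms
proof (induction "is")
  case (Cons i "is")
  have "list_all (\<lambda>(j, w). R i (f i) j w) (map (\<lambda>i. (i, f i)) is)"
    using Cons.prems by (auto simp: list_all_iff)
  moreover have "map (\<lambda>i. (i, f i)) is \<in> set (solutions R D is)"
    using Cons.prems by (intro Cons.IH) auto
  ultimately show ?case using Cons.prems(2)[of i] by force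
qed simp

text \<open>The first line encodes an involution, the second excludes squares made of two chords and
  two cycle edges.\<close>

definition chord_compatible :: "nat \<Rightarrow> nat \<Rightarrow> nat \<Rightarrow> nat \<Rightarrow> nat \<Rightarrow> bool" where
  "chord_compatible n i v j w \<longleftrightarrow> v \<noteq> w \<and> (v = j \<longleftrightarrow> w = i) \<and>
     (nxt n i j \<or> nxt n j i \<longrightarrow> \<not> nxt n v w \<and> \<not> nxt n w v)"

text \<open>The ways to complete the cycle to a cubic graph of girth at least 5. Reversal makes the
  search assign vertex 0 first.\<close>

definition chord_systems :: "nat \<Rightarrow> (nat \<times> nat) list list" where
  "chord_systems n = solutions (chord_compatible n) (\<lambda>i. filter (far n i) [0..<n]) (rev [0..<n])"

lemma (in labelled) chord_in_chord_systems:
  assumes "n \<ge> 7"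
  shows "map (\<lambda>i. (i, chord i)) (rev [0..<n]) \<in> set (chord_systems n)"
  unfolding chord_systems_def
proof (rule solutions_complete)
  fix i j assume "i \<in> set (rev [0..<n])" "j \<in> set (rev [0..<n])" "i \<noteq> j"
  then have ij: "i < n" "j < n" "i \<noteq> j" by auto
  then have "chord i \<noteq> chord j" "chord i = j \<longleftrightarrow> chord j = i" using chord_chord by metis+
  then show "chord_compatible n i (chord i) j (chord j)"
    using chord_not_parallel[OF assms] ij unfolding chord_compatible_def by blast
qed (use assms chord_far chord_less in auto)

section \<open>Perfect matchings and their complements\<close>

definition edge_list :: "nat \<Rightarrow> (nat \<times> nat) list \<Rightarrow> (nat \<times> nat) list" where
  "edge_list n ms = ms @ concat (map (\<lambda>i. [(i, succ n i), (succ n i, i)]) [0..<n])"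

text \<open>Cutting the domain of an endpoint of \<open>fs\<close> down to \<open>fs\<close> forces
  the prescribed edges; the constraint makes partners mutual.\<close>

definition matchings_containing :: "nat \<Rightarrow> (nat \<times> nat) list \<Rightarrow> (nat \<times> nat) list \<Rightarrow> (nat \<times> nat) list list" where
  "matchings_containing n es fs = solutions (\<lambda>i v j w. v = j \<longleftrightarrow> w = i)
     (\<lambda>i. map snd (filter (\<lambda>e. fst e = i)
        (if list_ex (\<lambda>e. fst e = i) fs then fs else es))) (rev [0..<n])"

text \<open>One pass through es need not reach the whole component of 0; closedness is therefore tested.\<close>
definition visibly_disconnected :: "nat \<Rightarrow> (nat \<times> nat) list \<Rightarrow> bool" where
  "visibly_disconnected n es =
     (\<lambda>S. list_all (\<lambda>(u, v). u \<in> set S \<longrightarrow> v \<in> set S) es \<and> \<not> list_all (\<lambda>v. v \<in> set S) [0..<n])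
       (fold (\<lambda>(u, v) S. if u \<in> set S \<and> v \<notin> set S then v # S else S) es [0])"

text \<open>Of the three edges at \<open>v\<close>, two lie on the cycle.\<close>

lemma (in cubic_4_ordered) omitted_edge:
  assumes H: "ham_cycle V E cs" and v: "v \<in> V"
  shows "\<exists>w. \<forall>u. E v u \<and> \<not> cyc_adj cs v u \<longleftrightarrow> u = w"
proof -
  have 2: "card {u. cyc_adj cs v u} = 2" using cyc_adj_neighbours[OF H v] .
  have "{u. cyc_adj cs v u} \<subseteq> {u. E v u}" using cyc_adj_edge[OF simple H] by blast
  moreover have "finite {u. cyc_adj cs v u}" using 2 card.infinite by fastforce
  ultimately have "card ({u. E v u} - {u. cyc_adj cs v u}) = 1"
    using card_neighbours[OF v] 2 by (subst card_Diff_subset) auto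
  then obtain w where "{u. E v u} - {u. cyc_adj cs v u} = {w}" by (auto simp: card_1_singleton_iff)
  then show ?thesis by blast
qed

context labelled
begin

abbreviation "edges \<equiv> edge_list n (map (\<lambda>i. (i, chord i)) (rev [0..<n]))"

lemma edge_iff_edges: "E u v \<longleftrightarrow> (u, v) \<in> set edges"
proof
  assume E: "E u v"
  then have "u < n" "v < n" using edge_in by auto
  then have "v = succ n u \<or> u = succ n v \<or> v = chord u" using chord(2) E nxt_iff_succ by blast
  then show "(u, v) \<in> set edges" using \<open>u < n\<close> \<open>v < n\<close> by (auto simp: edge_list_def)
next
  assume "(u, v) \<in> set edges"
  then consider "u < n" "v = chord u" | "u < n" "v = succ n u" | "v < n" "u = succ n v"
    by (auto simp: edge_list_def)
  then show "E u v" by cases (use chord(1) edge_succ edge_sym in blast)+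
qed

text \<open>The edges missing from a hamiltonian cycle of a cubic graph form a perfect matching.\<close>
lemma matching_with_connected_complement:
  assumes "distinct [a, b, c, d]" "E a c" "E b d"
  shows "\<exists>xs \<in> set (matchings_containing n edges [(a, c), (c, a), (b, d), (d, b)]).
    \<not> visibly_disconnected n (filter (\<lambda>e. e \<notin> set xs) edges)"
proof -
  have "{a, b, c, d} \<subseteq> {0..<n}" using assms(2,3) edge_in by blast
  then have abcd: "a < n" "b < n" "c < n" "d < n" by simp_all
  obtain cs where H: "ham_cycle {0..<n} E cs" "\<not> cyc_adj cs a c" "\<not> cyc_adj cs b d"
    using ham_cycle_avoiding[OF ordered assms(1)] abcd by auto
  have "\<forall>v\<in>{0..<n}. \<exists>w. \<forall>u. E v u \<and> \<not> cyc_adj cs v u \<longleftrightarrow> u = w"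
    using omitted_edge[OF H(1)] by blast
  \<comment> \<open>\<open>f\<close> sends each vertex to the other end of the edge omitted
    there.\<close>
  then obtain f where "\<forall>v\<in>{0..<n}. \<forall>u. E v u \<and> \<not> cyc_adj cs v u \<longleftrightarrow> u = f v"
    unfolding bchoice_iff by blast
  then have f: "E v u \<and> \<not> cyc_adj cs v u \<longleftrightarrow> u = f v" if "v < n" for v u using that by simp
  let ?xs = "map (\<lambda>i. (i, f i)) (rev [0..<n])" and ?fs = "[(a, c), (c, a), (b, d), (d, b)]"
  let ?es = "filter (\<lambda>e. e \<notin> set ?xs) edges"
  have "?xs \<in> set (matchings_containing n edges ?fs)"
    unfolding matchings_containing_def
  proof (rule solutions_complete)
    fix i assume "i \<in> set (rev [0..<n])"
    then have i: "i < n" by simp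
    have 1: "(i, f i) \<in> set edges" using f[OF i, of "f i"] edge_iff_edges by blast
    have 2: "(i, f i) \<in> set ?fs" if "list_ex (\<lambda>e. fst e = i) ?fs"
    proof -
      have fs: "f a = c" "f c = a" "f b = d" "f d = b"
        using f[of a c] f[of c a] f[of b d] f[of d b] abcd assms(2,3) H(2,3)
          edge_sym[of a c] edge_sym[of b d] cyc_adj_sym[of cs a c] cyc_adj_sym[of cs b d] by simp_all
      have "i = a \<or> i = c \<or> i = b \<or> i = d" using that by auto
      then show ?thesis using fs by (elim disjE) simp_all
    qed
    have "(i, f i) \<in> set (if list_ex (\<lambda>e. fst e = i) ?fs then ?fs else edges)"
      using 1 2 by (cases "list_ex (\<lambda>e. fst e = i) ?fs") (simp_all only: if_True if_False)
    then show "f i \<in> set (map snd (filter (\<lambda>e. fst e = i) (if list_ex (\<lambda>e. fst e = i) ?fs then ?fs else edges)))"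
      unfolding set_map set_filter by (intro image_eqI[of _ _ "(i, f i)"] CollectI conjI) simp_all
  next
    fix i j assume "i \<in> set (rev [0..<n])" "j \<in> set (rev [0..<n])"
    then have "i < n" "j < n" by auto
    then show "f i = j \<longleftrightarrow> f j = i"
      using f[of i j] f[of j i] edge_sym[of i j] cyc_adj_sym[of cs i j] by auto
  qed simp
  moreover have "\<not> visibly_disconnected n ?es"
  proof
    assume vd: "visibly_disconnected n ?es"
    define S where "S = set (fold (\<lambda>(u, v) S. if u \<in> set S \<and> v \<notin> set S then v # S else S) ?es [0])"
    have S: "\<forall>(u, v)\<in>set ?es. u \<in> S \<longrightarrow> v \<in> S" "\<not> (\<forall>v\<in>set [0..<n]. v \<in> S)"
      using vd unfolding visibly_disconnected_def S_def[symmetric] list_all_iff by blast+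
    \<comment> \<open>The pass never drops vertices, so \<open>S\<close> still contains its seed
      0.\<close>
    have grows: "set T \<subseteq> set (fold (\<lambda>(u, v) S. if u \<in> set S \<and> v \<notin> set S then v # S else S) es T)"
      for es :: "(nat \<times> nat) list" and T
    proof (induction es arbitrary: T)
      case (Cons e es)
      show ?case using Cons[of T] Cons[of "snd e # T"] by (cases e) auto
    qed simp
    have "0 \<in> S" using grows[of "[0]" ?es] unfolding S_def by simp
    have "S \<inter> {0..<n} = {0..<n}"
    proof (rule cyc_adj_closed[OF H(1)])
      show "S \<inter> {0..<n} \<noteq> {}" using \<open>0 \<in> S\<close> n_ge by auto
      fix u v assume u: "u \<in> S \<inter> {0..<n}" and uv: "cyc_adj cs u v"
      then have "E u v" using cyc_adj_edge[OF simple H(1)] by blast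
      \<comment> \<open>Edges of \<open>cs\<close> are not in the matching, so \<open>S\<close> is
        closed along the cycle.\<close>
      have "v \<noteq> f u" using f[of u v] u uv by simp
      then have "(u, v) \<notin> set ?xs" by auto
      then have "(u, v) \<in> set ?es" using \<open>E u v\<close> edge_iff_edges by (simp del: set_map)
      then show "v \<in> S \<inter> {0..<n}" using S(1) u \<open>E u v\<close> edge_in by blast
    qed simp
    then show False using S(2) by auto
  qed
  ultimately show ?thesis by blast
qed

end

section \<open>Exclusion of 8, 10 and 12 vertices\<close>

text \<open>Only antipodal chords are \<open>far\<close>, and those at consecutive vertices are
  parallel.\<close>

lemma chord_systems_8: "chord_systems 8 = []"
  by code_simp

text \<open>The Petersen graph is the only cubic graph of girth at least 5 on ten vertices, and it
  has no hamiltonian cycle.\<close>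

lemma chord_systems_10: "chord_systems 10 = []"
  by code_simp

text \<open>The four pairs of cycle edges were found by search: each chord system has one of them as a
  pair of edges that no hamiltonian cycle avoids.\<close>
lemma chord_systems_12:
  "list_all (\<lambda>ms. list_ex (\<lambda>fs. list_all
       (\<lambda>xs. visibly_disconnected 12 (filter (\<lambda>e. e \<notin> set xs) (edge_list 12 ms)))
       (matchings_containing 12 (edge_list 12 ms) fs))
     [[(0, 1), (1, 0), (7, 8), (8, 7)], [(1, 2), (2, 1), (6, 7), (7, 6)],
      [(0, 1), (1, 0), (5, 6), (6, 5)], [(0, 11), (11, 0), (6, 7), (7, 6)]]) (chord_systems 12)"
  by code_simp

lemma (in labelled) n_cases: "n = 4 \<or> n = 6 \<or> n \<ge> 14"
proof (rule ccontr)
  assume "\<not> ?thesis"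
  then have "n \<in> {8, 10, 12}" using n_ge even_n by (auto elim!: evenE)
  moreover have "n \<noteq> 8" using chord_in_chord_systems chord_systems_8 by auto
  moreover have "n \<noteq> 10" using chord_in_chord_systems chord_systems_10 by auto
  moreover have "n \<noteq> 12"
  proof
    assume n: "n = 12"
    have "map (\<lambda>i. (i, chord i)) (rev [0..<n]) \<in> set (chord_systems 12)"
      using chord_in_chord_systems n by simp
    then obtain fs where fs: "fs \<in> set [[(0, 1), (1, 0), (7, 8), (8, 7)], [(1, 2), (2, 1), (6, 7), (7, 6)],
        [(0, 1), (1, 0), (5, 6), (6, 5)], [(0, 11), (11, 0), (6, 7), (7, 6)]]"
      "\<forall>xs \<in> set (matchings_containing n edges fs).
         visibly_disconnected n (filter (\<lambda>e. e \<notin> set xs) edges)"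
      using chord_systems_12 unfolding list_all_iff list_ex_iff n by blast
    have E: "E u v" if "nxt n u v \<or> nxt n v u" "u < n" for u v using chord(2) that by blast
    \<comment> \<open>The tabulated edges lie on the labelled cycle, so they are present whatever
      the chords are.\<close>
    have "E 0 1" "E 7 8" "E 1 2" "E 6 7" "E 5 6" "E 0 11" by (rule E; simp add: nxt_def n)+
    moreover have "fs \<noteq> [(a, c), (c, a), (b, d), (d, b)]"
      if "distinct [a, b, c, d]" "E a c" "E b d" for a b c d
      using matching_with_connected_complement[OF that] fs(2) by blast
    ultimately have "fs \<noteq> [(0, 1), (1, 0), (7, 8), (8, 7)]" "fs \<noteq> [(1, 2), (2, 1), (6, 7), (7, 6)]"
      "fs \<noteq> [(0, 1), (1, 0), (5, 6), (6, 5)]" "fs \<noteq> [(0, 11), (11, 0), (6, 7), (7, 6)]"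
      by simp_all
    then show False using fs(1) by simp
  qed
  ultimately show False by blast
qed

section \<open>The graphs on 4 and 6 vertices\<close>

lemma (in labelled) iso_K4:
  assumes "n = 4"
  shows "graph_iso {0..<n} E K4_V K4_E"
proof -
  have "{u. E v u} = {0..<n} - {v}" if "v < n" for v
  proof (rule card_seteq)
    show "{u. E v u} \<subseteq> {0..<n} - {v}" using edge_in edge_irrefl by blast
    show "card ({0..<n} - {v}) \<le> card {u. E v u}" using card_neighbours that assms by simp
  qed simp
  then have "E v u \<longleftrightarrow> u < n \<and> u \<noteq> v" if "v < n" for u v using that by (auto simp: set_eq_iff)
  then show ?thesis unfolding graph_iso_def
    by (intro exI[of _ id]) (auto simp: K4_V_def K4_E_def assms)
qed

text \<open>A chord across two cycle edges would close a triangle, so all chords are antipodal;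
  edges then join exactly the labels of different parity.\<close>

lemma (in labelled) iso_K33:
  assumes n: "n = 6"
  shows "graph_iso {0..<n} E K33_V K33_E"
proof -
  have nE: "nxt n k l \<Longrightarrow> E k l" for k l using chord(2)[of k l] by (auto simp: nxt_def)
  have n5: "card {0..<n} \<ge> 5" using n by simp
  have opp: "\<not> (nxt n i l \<and> nxt n l (chord i))" "\<not> (nxt n (chord i) l \<and> nxt n l i)" if "i < n" for i l
    using no_triangle[OF n5, of i l "chord i"] no_triangle[OF n5, of "chord i" l i] nE chord(1)[OF that]
      edge_sym[of i "chord i"] by blast+
  have set6: "{0..<6} = {0, 1, 2, 3, 4, 5 :: nat}" by auto
  have c: "chord i = (if i < 3 then i + 3 else i - 3)" if "i < n" for i
  proof -
    have "i \<in> {0..<6}" "chord i \<in> {0..<6}" using that chord_less[OF that] n by auto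
    then show ?thesis
      using chord(3,4)[OF that] chord_neq[OF that] opp(1)[OF that, of "succ n i"]
        opp(2)[OF that, of "succ n (chord i)"]
      unfolding n nxt_def succ_def set6 by (elim insertE emptyE) simp_all
  qed
  have "nxt 6 i j \<or> nxt 6 j i \<or> j = (if i < 3 then i + 3 else i - 3) \<longleftrightarrow> even i \<noteq> even j"
    if "i \<in> {0..<6}" "j \<in> {0..<6}" for i j
    using that unfolding nxt_def set6 by (elim insertE emptyE) simp_all
  then have E: "E i j \<longleftrightarrow> even i \<noteq> even j" if "i < 6" "j < 6" for i j
    using that chord(2)[of i j] c[of i] n by simp
  \<comment> \<open>Even labels go to 0, 1, 2 and odd labels to 3, 4, 5.\<close>
  let ?f = "\<lambda>i::nat. if even i then i div 2 else 3 + i div 2"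
  have "bij_betw ?f {0..<6} K33_V"
    unfolding K33_V_def set6 by (auto simp: bij_betw_def)
  then show ?thesis unfolding graph_iso_def n
    by (intro exI[of _ ?f]) (auto simp: E K33_E_def K33_V_def)
qed

section \<open>Relabelling\<close>

lemma ham_cycle_map:
  assumes f: "bij_betw f V W" and E: "\<And>u v. u \<in> V \<Longrightarrow> v \<in> V \<Longrightarrow> E u v \<Longrightarrow> F (f u) (f v)"
    and H: "ham_cycle V E cs"
  shows "ham_cycle W F (map f cs)"
proof -
  have V: "set cs = V" and n: "length cs \<ge> 3" using H by (auto simp: ham_cycle_def)
  have "F (map f cs ! i) (map f cs ! ((i + 1) mod length cs))" if "i < length cs" for i
  proof -
    have i: "(i + 1) mod length cs < length cs" using n by (intro mod_less_divisor) linarith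
    then have "cs ! i \<in> V" "cs ! ((i + 1) mod length cs) \<in> V" using V that nth_mem by blast+
    moreover have "E (cs ! i) (cs ! ((i + 1) mod length cs))" using H that by (simp add: ham_cycle_def)
    ultimately show ?thesis using E that i by simp
  qed
  moreover have "distinct (map f cs)" "set (map f cs) = W"
    using f H V by (auto simp: distinct_map bij_betw_def ham_cycle_def)
  ultimately show ?thesis using n by (simp add: ham_cycle_def)
qed

lemma cyclic_order_in_map:
  assumes "cyclic_order_in vs cs"
  shows "cyclic_order_in (map f vs) (map f cs)"
  using assms unfolding cyclic_order_in_def rotate_map by (meson subseq_map)

text \<open>Pulls a prescribed sequence back along \<open>f\<close>, so that a cycle found in the
  source can be mapped forward.\<close>

lemma map_inv_into_bij:
  assumes f: "bij_betw f V W" and "set vs \<subseteq> W" "distinct vs"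
  obtains ws where "vs = map f ws" "distinct ws" "set ws \<subseteq> V" "length ws = length vs"
proof
  show "vs = map f (map (inv_into V f) vs)"
    using assms by (auto simp: bij_betw_def f_inv_into_f intro!: map_idI[symmetric])
  show "distinct (map (inv_into V f) vs)" "set (map (inv_into V f) vs) \<subseteq> V"
    using assms by (auto simp: distinct_map bij_betw_def inj_on_inv_into inv_into_into)
qed simp

lemma k_ordered_hamiltonian_map:
  assumes f: "bij_betw f V W" and E: "\<And>u v. u \<in> V \<Longrightarrow> v \<in> V \<Longrightarrow> E u v \<Longrightarrow> F (f u) (f v)"
    and "k_ordered_hamiltonian k V E"
  shows "k_ordered_hamiltonian k W F"
  unfolding k_ordered_hamiltonian_def
proof (intro allI impI)
  fix vs assume "length vs = k \<and> distinct vs \<and> set vs \<subseteq> W"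
  moreover then obtain ws where "vs = map f ws" "distinct ws" "set ws \<subseteq> V" "length ws = length vs"
    using map_inv_into_bij[OF f] by metis
  ultimately obtain cs where "ham_cycle V E cs" "cyclic_order_in (map f ws) (map f cs)" "vs = map f ws"
    using assms(3) cyclic_order_in_map unfolding k_ordered_hamiltonian_def by metis
  then show "\<exists>cs. ham_cycle W F cs \<and> cyclic_order_in vs cs"
    using ham_cycle_map[of f V W E F, OF f E] by metis
qed

lemma graph_iso_trans:
  assumes "graph_iso V E W F" "graph_iso W F X G"
  shows "graph_iso V E X G"
proof -
  obtain f g where "bij_betw f V W" "\<forall>u\<in>V. \<forall>v\<in>V. E u v \<longleftrightarrow> F (f u) (f v)"
    "bij_betw g W X" "\<forall>u\<in>W. \<forall>v\<in>W. F u v \<longleftrightarrow> G (g u) (g v)"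
    using assms unfolding graph_iso_def by blast
  then show ?thesis unfolding graph_iso_def
    by (intro exI[of _ "g \<circ> f"]) (auto intro: bij_betw_trans dest: bij_betwE)
qed

text \<open>Each vertex is replaced by its position on a hamiltonian cycle.\<close>

lemma (in cubic_4_ordered) labelling_exists:
  assumes "card V \<ge> 4"
  obtains F where "labelled (card V) F" "graph_iso V E {0..<card V} F"
proof -
  obtain cs where H: "ham_cycle V E cs" using ham_cycle_exists[OF assms] .
  have cs: "distinct cs" "set cs = V" and E: "\<And>i. i < length cs \<Longrightarrow> E (cs ! i) (cs ! ((i + 1) mod length cs))"
    using H by (auto simp: ham_cycle_def)
  define n where "n = card V"
  have len: "length cs = n" using cs distinct_card n_def by metis
  define F where "F i j \<longleftrightarrow> i < n \<and> j < n \<and> E (cs ! i) (cs ! j)" for i j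
  have f: "bij_betw ((!) cs) {0..<n} V"
    using bij_betw_nth[OF cs(1), of "{0..<n}" V] cs(2) len by (simp add: lessThan_atLeast0)
  then have g: "bij_betw (inv_into {0..<n} ((!) cs)) V {0..<n}" by (rule bij_betw_inv_into)
  let ?g = "inv_into {0..<n} ((!) cs)"
  have gF: "E u v \<longleftrightarrow> F (?g u) (?g v)" if "u \<in> V" "v \<in> V" for u v
  proof -
    have "?g u < n" "?g v < n" using bij_betwE[OF g] that by auto
    moreover have "cs ! ?g u = u" "cs ! ?g v = v" using f that by (simp_all add: bij_betw_inv_into_right)
    ultimately show ?thesis by (simp add: F_def)
  qed
  have "labelled n F"
  proof unfold_locales
    show "simple_graph {0..<n} F" using edge_sym edge_irrefl by (auto simp: simple_graph_def F_def)
    show "regular_graph 3 {0..<n} F" unfolding regular_graph_def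
    proof
      fix v assume v: "v \<in> {0..<n}"
      have "(!) cs ` {u \<in> {0..<n}. F v u} = {u. E (cs ! v) u}"
        using v f edge_in[of "cs ! v"] by (force simp: F_def bij_betw_def image_iff)
      moreover have "inj_on ((!) cs) {u \<in> {0..<n}. F v u}"
        using f by (auto simp: bij_betw_def intro: inj_on_subset)
      ultimately have "card {u \<in> {0..<n}. F v u} = card {u. E (cs ! v) u}" by (metis card_image)
      then show "card {u \<in> {0..<n}. F v u} = 3"
        using card_neighbours bij_betwE[OF f] v by simp
    qed
    show "k_ordered_hamiltonian 4 {0..<n} F"
      using k_ordered_hamiltonian_map[OF g _ ordered] gF by blast
    have "F i ((i + 1) mod n)" if "i < n" for i using E[of i] that len by (simp add: F_def)
    then show "ham_cycle {0..<n} F [0..<n]" using H len by (simp add: ham_cycle_def)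
  qed
  moreover have "graph_iso V E {0..<n} F" using g gF by (auto simp: graph_iso_def)
  ultimately show thesis using that n_def by simp
qed

text \<open>A vertex and its neighbours provide the four vertices needed for a labelling;
  isomorphisms of the labelled copy carry over to \<open>V\<close>.\<close>

lemma (in cubic_4_ordered) card_ge_14:
  assumes "V \<noteq> {}" "\<not> graph_iso V E K4_V K4_E" "\<not> graph_iso V E K33_V K33_E"
  shows "card V \<ge> 14"
proof -
  obtain v where v: "v \<in> V" using assms(1) by blast
  have "{u. E v u} \<subseteq> V - {v}" using edge_in edge_irrefl by blast
  then have "3 \<le> card (V - {v})" using card_mono[of "V - {v}" "{u. E v u}"] card_neighbours[OF v] finite_V by simp
  then have "card V \<ge> 4" using v finite_V by simp
  then obtain F where F: "labelled (card V) F" "graph_iso V E {0..<card V} F" using labelling_exists by blast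
  interpret L: labelled "card V" F by (rule F(1))
  show ?thesis using L.n_cases L.iso_K4 L.iso_K33 graph_iso_trans[OF F(2)] assms(2,3) by blast
qed

section \<open>The Heawood graph\<close>

definition heawood_edges :: "(nat \<times> nat) list" where
  "heawood_edges = [
    (0,1), (0,5), (0,13), (1,0), (1,2), (1,10), (2,1), (2,3), (2,7), (3,2), (3,4), (3,12),
    (4,3), (4,5), (4,9), (5,0), (5,4), (5,6), (6,5), (6,7), (6,11), (7,2), (7,6), (7,8),
    (8,7), (8,9), (8,13), (9,4), (9,8), (9,10), (10,1), (10,9), (10,11), (11,6), (11,10),
    (11,12), (12,3), (12,11), (12,13), (13,0), (13,8), (13,12)]"

text \<open>The automorphism of the dihedral group that takes 0 to v; the reflections are those that
  exchange the two sides of the bipartition.\<close>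
definition heawood_sym :: "nat \<Rightarrow> nat \<Rightarrow> nat" where
  "heawood_sym v u = (if even v then (v + u) mod 14 else (v + 14 - u) mod 14)"

fun after :: "nat \<Rightarrow> nat list \<Rightarrow> nat list" where
  "after x [] = []"
| "after x (y # ys) = (if x = y then ys else after x ys)"

text \<open>Since \<open>after\<close> returns the empty list when \<open>x\<close> is absent, a
  nonempty \<open>xs\<close> guarantees that \<open>x\<close> occurs.\<close>

lemma subseq_after:
  assumes "subseq xs (after x ys)" "xs \<noteq> []"
  shows "subseq (x # xs) ys"
  using assms by (induction ys) (auto split: if_splits)

text \<open>Eighteen hamiltonian cycles, each in both directions and written from 0.\<close>

definition heawood_cycles :: "nat list list" where
  "heawood_cycles = [
    [0,1,2,3,4,5,6,7,8,9,10,11,12,13],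
    [0,13,12,11,10,9,8,7,6,5,4,3,2,1],
    [0,1,10,11,6,7,2,3,12,13,8,9,4,5],
    [0,5,4,9,8,13,12,3,2,7,6,11,10,1],
    [0,5,6,11,12,3,4,9,10,1,2,7,8,13],
    [0,13,8,7,2,1,10,9,4,3,12,11,6,5],
    [0,1,2,7,6,5,4,3,12,11,10,9,8,13],
    [0,13,8,9,10,11,12,3,4,5,6,7,2,1],
    [0,1,10,9,4,3,2,7,8,13,12,11,6,5],
    [0,5,6,11,12,13,8,7,2,3,4,9,10,1],
    [0,5,4,9,8,7,6,11,10,1,2,3,12,13],
    [0,13,12,3,2,1,10,11,6,7,8,9,4,5],
    [0,1,2,3,4,9,10,11,12,13,8,7,6,5],
    [0,5,6,7,8,13,12,11,10,9,4,3,2,1],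
    [0,5,4,3,12,11,6,7,2,1,10,9,8,13],
    [0,13,8,9,10,1,2,7,6,11,12,3,4,5],
    [0,1,10,11,6,5,4,9,8,7,2,3,12,13],
    [0,13,12,3,2,7,8,9,4,5,6,11,10,1],
    [0,1,2,7,6,11,10,9,8,13,12,3,4,5],
    [0,5,4,3,12,13,8,9,10,11,6,7,2,1],
    [0,1,10,9,4,5,6,11,12,3,2,7,8,13],
    [0,13,8,7,2,3,12,11,6,5,4,9,10,1],
    [0,5,6,7,8,9,4,3,2,1,10,11,12,13],
    [0,13,12,11,10,1,2,3,4,9,8,7,6,5],
    [0,1,2,3,12,13,8,7,6,11,10,9,4,5],
    [0,5,4,9,10,11,6,7,8,13,12,3,2,1],
    [0,1,2,3,12,11,10,9,4,5,6,7,8,13],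
    [0,13,8,7,6,5,4,9,10,11,12,3,2,1],
    [0,5,6,7,2,1,10,11,12,3,4,9,8,13],
    [0,13,8,9,4,3,12,11,10,1,2,7,6,5],
    [0,1,2,7,8,9,10,11,6,5,4,3,12,13],
    [0,13,12,3,4,5,6,11,10,9,8,7,2,1],
    [0,1,10,11,12,13,8,9,4,3,2,7,6,5],
    [0,5,6,7,2,3,4,9,8,13,12,11,10,1],
    [0,5,4,3,2,1,10,9,8,7,6,11,12,13],
    [0,13,12,11,6,7,8,9,10,1,2,3,4,5]]"

text \<open>Ties the table to \<open>heawood_E\<close>, so that later evaluations only look up
  edges.\<close>

lemma heawood_edges_filter: "filter (\<lambda>(u, w). heawood_E u w) (List.product [0..<14] [0..<14]) = heawood_edges"
  by code_simp

text \<open>Zipping with \<open>rotate1\<close> yields the cyclically consecutive pairs, including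
  the closing one.\<close>

lemma heawood_cycles_check:
  "list_all (\<lambda>cs. distinct cs \<and> length cs = 14 \<and> list_all (\<lambda>v. v < 14) cs \<and>
     list_all (\<lambda>e. e \<in> set heawood_edges) (zip cs (rotate1 cs))) heawood_cycles"
  by code_simp

lemma heawood_sym_check:
  "list_all (\<lambda>v. distinct (map (heawood_sym v) [0..<14]) \<and>
     list_all (\<lambda>(u, w). (heawood_sym v u, heawood_sym v w) \<in> set heawood_edges) heawood_edges) [0..<14]"
  by code_simp

lemma heawood_degree_check:
  "list_all (\<lambda>v. length (filter (\<lambda>u. (v, u) \<in> set heawood_edges) [0..<14]) = 3) [0..<14]"
  by code_simp

text \<open>Sharing the suffixes between sequences with a common prefix keeps this evaluation feasible.\<close>
lemma heawood_orders_check: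
  "list_all (\<lambda>a. let L = map (\<lambda>cs. after a (after 0 cs)) heawood_cycles in
     list_all (\<lambda>b. a = b \<or> (let M = concat (map (after b) L) in
       list_all (\<lambda>c. a = c \<or> b = c \<or> c \<in> set M) [1..<14])) [1..<14]) [1..<14]"
  by code_simp

section \<open>4-orderedness of the Heawood graph\<close>

lemma heawood_E_iff: "heawood_E u w \<longleftrightarrow> (u, w) \<in> set heawood_edges"
  unfolding heawood_edges_filter[symmetric] by (auto simp: heawood_E_def heawood_V_def)

lemma heawood_cycles_ham:
  assumes "cs \<in> set heawood_cycles"
  shows "ham_cycle heawood_V heawood_E cs"
proof -
  have cs: "distinct cs" "length cs = 14" "set cs \<subseteq> heawood_V"
    "\<And>e. e \<in> set (zip cs (rotate1 cs)) \<Longrightarrow> e \<in> set heawood_edges"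
    using heawood_cycles_check assms by (auto simp: list_all_iff heawood_V_def)
  have "set cs = heawood_V"
    using cs by (intro card_subset_eq) (simp_all add: distinct_card heawood_V_def)
  moreover have "heawood_E (cs ! i) (cs ! ((i + 1) mod length cs))" if "i < length cs" for i
    unfolding heawood_E_iff using that
    by (intro cs(4)) (auto simp: in_set_zip nth_rotate1 intro!: exI[of _ i])
  ultimately show ?thesis using cs by (simp add: ham_cycle_def)
qed

lemma heawood_sym_bij:
  assumes "v \<in> heawood_V"
  shows "bij_betw (heawood_sym v) heawood_V heawood_V"
proof -
  have "inj_on (heawood_sym v) heawood_V"
    using heawood_sym_check assms by (simp add: list_all_iff heawood_V_def distinct_map)
  moreover have "heawood_sym v ` heawood_V \<subseteq> heawood_V" by (auto simp: heawood_sym_def heawood_V_def)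
  ultimately show ?thesis
    using endo_inj_surj[of heawood_V "heawood_sym v"] by (auto simp: bij_betw_def heawood_V_def)
qed

lemma heawood_sym_edge:
  assumes "v \<in> heawood_V" "heawood_E u w"
  shows "heawood_E (heawood_sym v u) (heawood_sym v w)"
  using heawood_sym_check assms by (auto simp: list_all_iff heawood_V_def heawood_E_iff)

lemma heawood_cycle_through_0:
  assumes "distinct [0, a, b, c]" "{a, b, c} \<subseteq> heawood_V"
  obtains cs where "ham_cycle heawood_V heawood_E cs" "cyclic_order_in [0, a, b, c] cs"
proof -
  have "a \<in> set [1..<14]" "b \<in> set [1..<14]" "c \<in> set [1..<14]" "a \<noteq> b" "a \<noteq> c" "b \<noteq> c"
    using assms by (auto simp: heawood_V_def)
  then obtain cs where cs: "cs \<in> set heawood_cycles" "c \<in> set (after b (after a (after 0 cs)))"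
    using heawood_orders_check unfolding list_all_iff Let_def by fastforce
  have "subseq [c] (after b (after a (after 0 cs)))" using cs(2) by (simp add: subseq_singleton_left)
  \<comment> \<open>The trivial rotation suffices because the listed cycles begin with 0.\<close>
  then have "subseq [0, a, b, c] (rotate 0 cs)" by (simp add: subseq_after)
  then show thesis using that heawood_cycles_ham[OF cs(1)] unfolding cyclic_order_in_def by blast
qed

text \<open>The symmetry taking 0 to the first vertex reduces the claim to sequences starting in 0,
  and maps the cycle found there forward.\<close>

lemma heawood_4_ordered: "k_ordered_hamiltonian 4 heawood_V heawood_E"
  unfolding k_ordered_hamiltonian_def
proof (intro allI impI)
  fix vs :: "nat list" assume vs: "length vs = 4 \<and> distinct vs \<and> set vs \<subseteq> heawood_V"
  then obtain v a b c where abc: "vs = [v, a, b, c]"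
    by (auto simp: numeral_eq_Suc length_Suc_conv)
  have v: "v \<in> heawood_V" using vs abc by simp
  let ?f = "heawood_sym v"
  obtain ws where ws: "vs = map ?f ws" "distinct ws" "set ws \<subseteq> heawood_V" "length ws = length vs"
    using map_inv_into_bij[OF heawood_sym_bij[OF v]] vs by metis
  obtain z a' b' c' where ws': "ws = [z, a', b', c']"
    using ws(4) unfolding abc by (auto simp: length_Suc_conv)
  have "?f 0 = v" using v by (auto simp: heawood_sym_def heawood_V_def)
  moreover have "?f z = v" "z \<in> heawood_V" using ws ws' abc by auto
  moreover have "0 \<in> heawood_V" by (simp add: heawood_V_def)
  ultimately have "z = 0" using heawood_sym_bij[OF v] by (metis bij_betw_def inj_onD)
  then obtain cs where "ham_cycle heawood_V heawood_E cs" "cyclic_order_in ws cs"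
    using heawood_cycle_through_0[of a' b' c'] ws ws' by auto
  then show "\<exists>cs. ham_cycle heawood_V heawood_E cs \<and> cyclic_order_in vs cs"
    using ham_cycle_map[OF heawood_sym_bij[OF v]] heawood_sym_edge[OF v] cyclic_order_in_map ws(1) by metis
qed

section \<open>Simplicity, connectedness and regularity\<close>

lemma heawood_simple: "simple_graph heawood_V heawood_E"
proof -
  have "\<not> heawood_E v v" for v unfolding heawood_E_iff heawood_edges_def by auto
  then show ?thesis by (auto simp: simple_graph_def heawood_V_def heawood_E_def)
qed

text \<open>The path 0, 1, ..., 13 joins 0 to every vertex.\<close>

lemma heawood_connected: "connected_graph heawood_V heawood_E"
proof -
  let ?R = "{(x, y). heawood_E x y}"
  have 0: "i < 14 \<Longrightarrow> (0, i) \<in> ?R\<^sup>*" for i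
  proof (induction i)
    case (Suc i)
    then have "(i, Suc i) \<in> ?R" by (auto simp: heawood_E_def heawood_V_def)
    then show ?case using Suc by (meson Suc_lessD rtrancl.rtrancl_into_rtrancl)
  qed simp
  have "sym (?R\<^sup>*)" using heawood_simple by (intro sym_rtrancl symI) (auto simp: simple_graph_def)
  then have "(i, j) \<in> ?R\<^sup>*" if "i < 14" "j < 14" for i j
    using 0[OF that(1)] 0[OF that(2)] by (meson rtrancl_trans symD)
  then show ?thesis by (auto simp: connected_graph_def heawood_V_def)
qed

lemma heawood_regular: "regular_graph 3 heawood_V heawood_E"
  unfolding regular_graph_def
proof
  fix v assume "v \<in> heawood_V"
  then have "length (filter (\<lambda>u. (v, u) \<in> set heawood_edges) [0..<14]) = 3"
    using heawood_degree_check by (simp add: list_all_iff heawood_V_def)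
  moreover have "{u \<in> heawood_V. heawood_E v u} = set (filter (\<lambda>u. (v, u) \<in> set heawood_edges) [0..<14])"
    by (auto simp: heawood_V_def heawood_E_iff)
  ultimately show "card {u \<in> heawood_V. heawood_E v u} = 3"
    by (simp add: distinct_card del: set_filter)
qed

theorem theorem3p4:
  shows "(\<forall>(V :: 'a set) E. simple_graph V E \<and> connected_graph V E \<and> regular_graph 3 V E
            \<and> k_ordered_hamiltonian 4 V E
            \<and> \<not> graph_iso V E K4_V K4_E \<and> \<not> graph_iso V E K33_V K33_E
            \<longrightarrow> card V \<ge> 14)
     \<and> (simple_graph heawood_V heawood_E \<and> connected_graph heawood_V heawood_E
        \<and> card heawood_V = 14 \<and> regular_graph 3 heawood_V heawood_E
        \<and> k_ordered_hamiltonian 4 heawood_V heawood_E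
        \<and> \<not> graph_iso heawood_V heawood_E K4_V K4_E
        \<and> \<not> graph_iso heawood_V heawood_E K33_V K33_E)"
proof -
  have "card V \<ge> 14" if "simple_graph V E \<and> connected_graph V E \<and> regular_graph 3 V E
      \<and> k_ordered_hamiltonian 4 V E
      \<and> \<not> graph_iso V E K4_V K4_E \<and> \<not> graph_iso V E K33_V K33_E" for V :: "'a set" and E
    using that cubic_4_ordered.card_ge_14[of V E]
    by (auto simp: cubic_4_ordered_def connected_graph_def)
  moreover have "card heawood_V = 14" "card K4_V = 4" "card K33_V = 6"
    by (simp_all add: heawood_V_def K4_V_def K33_V_def)
  \<comment> \<open>An isomorphism preserves the number of vertices, which separates the Heawood
    graph from K4 and K33.\<close>
  moreover have "\<not> graph_iso heawood_V heawood_E W F" if "card W \<noteq> 14" for W :: "nat set" and F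
    using that \<open>card heawood_V = 14\<close> bij_betw_same_card unfolding graph_iso_def by metis
  ultimately show ?thesis
    using heawood_simple heawood_connected heawood_regular heawood_4_ordered by auto
qed

end
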